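(* The only odd pristine positive integer is $1$; that is, if $n > 1$ is odd then $a(n) \neq n$.
   Context: For positive integers, write $m \lfloor n$ to mean that $m$ is a proper divisor of $n$. The number of recursive divisors is defined by $a(1)=1$ and $a(n) = 1 + \sum_{m \lfloor n} a(m)$ for $n>1$. A positive integer $n$ is pristine if $a(n) = n$. *)

theory Defs
  imports Main
begin

definition proper_divisors :: "nat \<Rightarrow> nat set" where
  "proper_divisors n = {m. m dvd n \<and> m < n}"

(* Only positive arguments are meaningful; the value at 0 is a dummy. *)
function recursive_divisors :: "nat \<Rightarrow> nat" where
  "recursive_divisors n =
     (if n \<le> 1 then 1
      else 1 + (\<Sum>m\<in>proper_divisors n. recursive_divisors m))"
  by pat_completeness auto
termination
  by (relation "measure id") (auto simp: proper_divisors_def)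

(* The defining equation loops as a simplification rule. *)
declare recursive_divisors.simps [simp del]

definition pristine :: "nat \<Rightarrow> bool" where
  "pristine n \<longleftrightarrow> 0 < n \<and> recursive_divisors n = n"

end

theory Submission imports Defs begin

text \<open>The obstruction is parity: a(n) is even for every n > 1, so it cannot equal an odd n >
  1, and only n = 1 is left, where a(1) = 1. Evenness (\<open>even_recursive_divisors\<close>)
  follows by strong induction: in the recursion the leading 1 pairs with the term a(1) = 1 of the
  divisor 1, and every other proper divisor contributes an even number.\<close>

lemma even_recursive_divisors: "n > 1 \<Longrightarrow> even (recursive_divisors n)"
proof (induction n rule: less_induct)
  case (less n)
  have fin: "finite (proper_divisors n)"
    by (simp add: proper_divisors_def)
  have one: "1 \<in> proper_divisors n"
    using less.prems by (simp add: proper_divisors_def)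
  have "even (recursive_divisors m)" if "m \<in> proper_divisors n - {1}" for m
  proof -
    have "m dvd n" "m < n" "m \<noteq> 1"
      using that by (auto simp: proper_divisors_def)
    \<comment> \<open>Zero divides only zero, so m = 0 would force n = 0, against m < n. Together
      with m \<noteq> 1 this gives the bound m > 1 that the induction hypothesis demands.\<close>
    moreover from this have "m \<noteq> 0"
      by (auto intro: Nat.gr0I)
    ultimately show ?thesis
      using less.IH by simp
  qed
  then have "even (\<Sum>m\<in>proper_divisors n - {1}. recursive_divisors m)"
    by (rule dvd_sum)
  \<comment> \<open>Since n > 1, the number 1 is a proper divisor of n; isolating its term exposes
    the only two odd summands, 1 and a(1), whose total is 2.\<close>
  moreover have "recursive_divisors n
      = 1 + (recursive_divisors 1 + (\<Sum>m\<in>proper_divisors n - {1}. recursive_divisors m))"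
    using less.prems sum.remove[OF fin one, of recursive_divisors]
    by (simp add: recursive_divisors.simps[of n])
  moreover have "recursive_divisors 1 = 1"
    by (simp add: recursive_divisors.simps)
  ultimately show ?case
    by simp
qed

theorem theorem3:
  "{n::nat. odd n \<and> pristine n} = {1} \<and>
   (\<forall>n::nat. n > 1 \<and> odd n \<longrightarrow> recursive_divisors n \<noteq> n)"
proof
  show odd_neq: "\<forall>n::nat. n > 1 \<and> odd n \<longrightarrow> recursive_divisors n \<noteq> n"
    using even_recursive_divisors by metis
  have "pristine 1"
    by (simp add: pristine_def recursive_divisors.simps)
  moreover have "n = 1" if "odd n" "pristine n" for n
    using that odd_neq by (metis pristine_def less_one linorder_neqE_nat not_gr_zero)
  ultimately show "{n::nat. odd n \<and> pristine n} = {1}"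
    by auto
qed

end
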